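(* Let $G$ be a finite simple graph that is $K_{2,2,2}$-free and hole-edge-disjoint, and let $h(G)$ denote the number of holes of $G$. Suppose there exists a hole $C$ of $G$ such that $|\{e\in E(C): S_{C,e}^{(G)}\neq\emptyset\}|\geq h(G)$. Then $G$ has the chordal property. Consequently, $G$ has a chordal cut.
   Context: A hole is a chordless cycle of length at least $4$. $G$ is hole-edge-disjoint if its holes are pairwise edge-disjoint; $G$ is $K_{2,2,2}$-free if it has no induced subgraph isomorphic to $K_{2,2,2}$. For a hole $C$, let $X_C=\{v\in V(G): uv\in E(G)\text{ for all }u\in V(C)\}$. A path $W$ is $C$-avoiding if (1) none of its internal vertices lies in $V(C)\cup X_C$, and (2) if $W$ has length $1$, at least one of its two vertices is not in $V(C)\cup X_C$. For an edge $e=uv$ of $C$, let $\mathcal{P}_{C,uv}$ be the set of $C$-avoiding $(u,v)$-paths, $X_{C,e}=X_C\cup\{u,v\}$, $S_{C,e}^{(G)}=\bigcup_{P\in\mathcal{P}_{C,uv}}V(P)\setminus\{u,v\}$, $T_{C,e}=\{w: uwv\in\mathcal{P}_{C,uv}\}$. Let $Q_{C,e}$ be the connected component of $G-X_{C,e}$ containing $V(C)\setminus\{u,v\}$, and $U_{C,e}$ the union of those connected components of $G-X_{C,e}-Q_{C,e}$ that contain a vertex of $T_{C,e}$. $G$ has the chordal property if there exist a hole $C$ and $e\in E(C)$ such that $G[V(U_{C,e})\cup X_{C,e}]$ is chordal. A clique cut is a set $X\subseteq V(G)$ with $G[X]$ complete such that $G-X$ has more connected components than $G$; a clique cut $X$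 is a chordal cut if there is a union $U$ of connected components of $G-X$ such that $G[U\cup X]$ is chordal. *)

theory Defs
  imports Main
begin

datatype 'a graph = Graph (verts: "'a set") (edges: "'a set set")

definition finite_simple_graph :: "'a graph \<Rightarrow> bool" where
  "finite_simple_graph G \<longleftrightarrow> finite (verts G) \<and>
     (\<forall>e\<in>edges G. \<exists>u v. e = {u, v} \<and> u \<noteq> v \<and> u \<in> verts G \<and> v \<in> verts G)"

definition induced_subgraph :: "'a graph \<Rightarrow> 'a set \<Rightarrow> 'a graph" where
  "induced_subgraph G S = Graph (verts G \<inter> S) {e \<in> edges G. e \<subseteq> S}"

definition delete_verts :: "'a graph \<Rightarrow> 'a set \<Rightarrow> 'a graph" where
  "delete_verts G X = induced_subgraph G (verts G - X)"

definition isomorphic :: "'a graph \<Rightarrow> 'b graph \<Rightarrow> bool" where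
  "isomorphic G H \<longleftrightarrow> (\<exists>f. bij_betw f (verts G) (verts H) \<and>
     (\<forall>u\<in>verts G. \<forall>v\<in>verts G. {u, v} \<in> edges G \<longleftrightarrow> {f u, f v} \<in> edges H))"

definition complete :: "'a graph \<Rightarrow> bool" where
  "complete G \<longleftrightarrow> (\<forall>u\<in>verts G. \<forall>v\<in>verts G. u \<noteq> v \<longrightarrow> {u, v} \<in> edges G)"

text \<open>The vertex \<open>(i, j)\<close> is the \<open>j\<close>-th vertex of the \<open>i\<close>-th part.\<close>

definition K222 :: "(nat \<times> nat) graph" where
  "K222 = (let V = {0, 1, 2} \<times> {0, 1}
           in Graph V {{x, y} | x y. x \<in> V \<and> y \<in> V \<and> fst x \<noteq> fst y})"

definition K222_free :: "'a graph \<Rightarrow> bool" where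
  "K222_free G \<longleftrightarrow> \<not> (\<exists>S \<subseteq> verts G. isomorphic (induced_subgraph G S) K222)"

text \<open>A path is the list of its vertices; its length is one less than the length of the list.\<close>

definition is_path :: "'a graph \<Rightarrow> 'a list \<Rightarrow> bool" where
  "is_path G p \<longleftrightarrow> p \<noteq> [] \<and> distinct p \<and> set p \<subseteq> verts G \<and>
     (\<forall>i. Suc i < length p \<longrightarrow> {p ! i, p ! Suc i} \<in> edges G)"

definition inner_verts :: "'a list \<Rightarrow> 'a set" where
  "inner_verts p = set (butlast (tl p))"

text \<open>Connected components are represented by their vertex sets.\<close>

definition component_of :: "'a graph \<Rightarrow> 'a \<Rightarrow> 'a set" where
  "component_of G v = {w. \<exists>p. is_path G p \<and> hd p = v \<and> last p = w}"

definition components :: "'a graph \<Rightarrow> 'a set set" where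
  "components G = component_of G ` verts G"

text \<open>Cycles, and hence holes, are subgraphs: the starting point and the orientation of the
  enumeration \<open>vs\<close> are forgotten, so that each hole is counted once.\<close>

definition cycle_graph :: "'a list \<Rightarrow> 'a graph" where
  "cycle_graph vs =
     Graph (set vs) {{vs ! i, vs ! (Suc i mod length vs)} | i. i < length vs}"

definition is_cycle :: "'a graph \<Rightarrow> 'a graph \<Rightarrow> bool" where
  "is_cycle G C \<longleftrightarrow> verts C \<subseteq> verts G \<and> edges C \<subseteq> edges G \<and>
     (\<exists>vs. distinct vs \<and> length vs \<ge> 3 \<and> C = cycle_graph vs)"

definition chordless :: "'a graph \<Rightarrow> 'a graph \<Rightarrow> bool" where
  "chordless G C \<longleftrightarrow> (\<forall>e\<in>edges G. e \<subseteq> verts C \<longrightarrow> e \<in> edges C)"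

definition holes :: "'a graph \<Rightarrow> 'a graph set" where
  "holes G = {C. is_cycle G C \<and> chordless G C \<and> card (edges C) \<ge> 4}"

definition chordal :: "'a graph \<Rightarrow> bool" where
  "chordal G \<longleftrightarrow> holes G = {}"

definition hole_edge_disjoint :: "'a graph \<Rightarrow> bool" where
  "hole_edge_disjoint G \<longleftrightarrow>
     (\<forall>C\<in>holes G. \<forall>D\<in>holes G. C \<noteq> D \<longrightarrow> edges C \<inter> edges D = {})"

text \<open>In the following, \<open>X_hole G C\<close> is $X_C$, while \<open>avoiding_paths G C e\<close>, \<open>X_edge G C e\<close>,
  \<open>S_edge G C e\<close>, \<open>T_edge G C e\<close>, \<open>Q_edge G C e\<close>, \<open>U_edge G C e\<close> are ${\cal P}_{C,uv}$,
  $X_{C,e}$, $S_{C,e}^{(G)}$, $T_{C,e}$, $V(Q_{C,e})$, $V(U_{C,e})$ for the edge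
  \<open>e = {u, v}\<close>. As \<open>e\<close> is unordered, \<open>avoiding_paths\<close> contains each path in both directions.\<close>

definition X_hole :: "'a graph \<Rightarrow> 'a graph \<Rightarrow> 'a set" where
  "X_hole G C = {v \<in> verts G. \<forall>u\<in>verts C. {u, v} \<in> edges G}"

definition avoiding :: "'a graph \<Rightarrow> 'a graph \<Rightarrow> 'a list \<Rightarrow> bool" where
  "avoiding G C p \<longleftrightarrow>
     inner_verts p \<inter> (verts C \<union> X_hole G C) = {} \<and>
     (length p = 2 \<longrightarrow> (\<exists>w\<in>set p. w \<notin> verts C \<union> X_hole G C))"

definition avoiding_paths :: "'a graph \<Rightarrow> 'a graph \<Rightarrow> 'a set \<Rightarrow> 'a list set" where
  "avoiding_paths G C e = {p. is_path G p \<and> {hd p, last p} = e \<and> avoiding G C p}"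

definition X_edge :: "'a graph \<Rightarrow> 'a graph \<Rightarrow> 'a set \<Rightarrow> 'a set" where
  "X_edge G C e = X_hole G C \<union> e"

definition S_edge :: "'a graph \<Rightarrow> 'a graph \<Rightarrow> 'a set \<Rightarrow> 'a set" where
  "S_edge G C e = (\<Union>p\<in>avoiding_paths G C e. set p) - e"

definition T_edge :: "'a graph \<Rightarrow> 'a graph \<Rightarrow> 'a set \<Rightarrow> 'a set" where
  "T_edge G C e = {w. \<exists>u v. e = {u, v} \<and> [u, w, v] \<in> avoiding_paths G C e}"

definition Q_edge :: "'a graph \<Rightarrow> 'a graph \<Rightarrow> 'a set \<Rightarrow> 'a set" where
  "Q_edge G C e =
     (THE K. K \<in> components (delete_verts G (X_edge G C e)) \<and> verts C - e \<subseteq> K)"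

definition U_edge :: "'a graph \<Rightarrow> 'a graph \<Rightarrow> 'a set \<Rightarrow> 'a set" where
  "U_edge G C e =
     \<Union> {K \<in> components (delete_verts (delete_verts G (X_edge G C e)) (Q_edge G C e)).
          K \<inter> T_edge G C e \<noteq> {}}"

definition chordal_property :: "'a graph \<Rightarrow> bool" where
  "chordal_property G \<longleftrightarrow> (\<exists>C\<in>holes G. \<exists>e\<in>edges C.
     chordal (induced_subgraph G (U_edge G C e \<union> X_edge G C e)))"

definition clique_cut :: "'a graph \<Rightarrow> 'a set \<Rightarrow> bool" where
  "clique_cut G X \<longleftrightarrow> X \<subseteq> verts G \<and> complete (induced_subgraph G X) \<and>
     card (components (delete_verts G X)) > card (components G)"

text \<open>The family \<open>\<K>\<close> of components is required to be nonempty: with the empty union, every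
  clique cut would be a chordal cut.\<close>

definition chordal_cut :: "'a graph \<Rightarrow> 'a set \<Rightarrow> bool" where
  "chordal_cut G X \<longleftrightarrow> clique_cut G X \<and>
     (\<exists>\<K> \<subseteq> components (delete_verts G X). \<K> \<noteq> {} \<and>
        chordal (induced_subgraph G (\<Union>\<K> \<union> X)))"

end

theory Submission
  imports Defs
begin

text \<open>
  Fix a hole \<open>C\<close> and a connected set \<open>K\<close> of vertices outside \<open>C\<close> and $X_C$. The neighbours of \<open>K\<close>
  on \<open>C\<close> are pairwise adjacent, since otherwise rerouting \<open>C\<close> through \<open>K\<close> gives a second hole
  sharing an edge with \<open>C\<close>; as \<open>C\<close> has no triangle, they lie on a single edge of \<open>C\<close>. Hence for
  distinct edges \<open>e\<close> the sets $U_{C,e}$ are disjoint, and $X_{C,e}$, a clique as \<open>G\<close> is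
  $K_{2,2,2}$-free and hole-edge-disjoint, separates $U_{C,e}$ from the rest of \<open>C\<close>. If none of the graphs
  $G[U_{C,e} \cup X_{C,e}]$ with $S_{C,e}$ nonempty were chordal, then each of them would contain a
  hole; such a hole meets $U_{C,e}$ because $X_{C,e}$ is a clique, so these holes are pairwise distinct
  and distinct from \<open>C\<close>, which makes more than \<open>h(G)\<close> of them.
\<close>

section \<open>Induced paths and holes\<close>

lemma last_take_Suc: "i < length p \<Longrightarrow> last (take (Suc i) p) = p ! i"
  by (simp add: take_Suc_conv_app_nth)

lemma verts_cycle_graph [simp]: "verts (cycle_graph vs) = set vs"
  by (simp add: cycle_graph_def)

lemma edges_cycle_graph_Cons:
  assumes "r \<noteq> []"
  shows "edges (cycle_graph (y # r)) =
    {{r ! i, r ! Suc i} | i. Suc i < length r} \<union> {{y, hd r}, {y, last r}}"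
proof -
  obtain m where m: "length r = Suc m" using assms by (cases r) auto
  have e: "edges (cycle_graph (y # r)) =
      (\<lambda>i. {(y # r) ! i, (y # r) ! (Suc i mod Suc (Suc m))}) ` {..<Suc (Suc m)}"
    by (auto simp: cycle_graph_def m)
  have s: "{..<Suc (Suc m)} = insert 0 (insert (Suc m) (Suc ` {..<m}))"
    by (simp only: lessThan_Suc_eq_insert_0[of "Suc m"] lessThan_Suc[of m] image_insert)
  have "edges (cycle_graph (y # r)) =
      insert {y, r ! 0} (insert {r ! m, y} ((\<lambda>i. {r ! i, r ! Suc i}) ` {..<m}))"
    unfolding e s image_insert image_image by (intro arg_cong2[of _ _ _ _ insert] image_cong) auto
  also have "(\<lambda>i. {r ! i, r ! Suc i}) ` {..<m} = {{r ! i, r ! Suc i} | i. Suc i < length r}"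
    by (auto simp: m)
  finally show ?thesis using assms m
    by (simp add: hd_conv_nth last_conv_nth insert_commute)
qed

text \<open>This lets an enumeration of a hole start at any chosen vertex; see
  \<open>hole_at\<close>.\<close>

lemma cycle_graph_rotate: "cycle_graph (rotate k vs) = cycle_graph vs"
proof (cases "vs = []")
  case False
  let ?n = "length vs"
  have n: "?n > 0" using False by simp
  have "(\<exists>i<?n. e = {rotate k vs ! i, rotate k vs ! (Suc i mod ?n)}) \<longleftrightarrow>
        (\<exists>i<?n. e = {vs ! i, vs ! (Suc i mod ?n)})" for e
  proof
    assume "\<exists>i<?n. e = {rotate k vs ! i, rotate k vs ! (Suc i mod ?n)}"
    then obtain i where i: "i < ?n" "e = {rotate k vs ! i, rotate k vs ! (Suc i mod ?n)}" by blast
    have "e = {vs ! ((k + i) mod ?n), vs ! (Suc ((k + i) mod ?n) mod ?n)}"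
      using i n by (simp add: nth_rotate mod_simps)
    then show "\<exists>i<?n. e = {vs ! i, vs ! (Suc i mod ?n)}" using n
      by (intro exI[of _ "(k + i) mod ?n"]) simp
  next
    assume "\<exists>i<?n. e = {vs ! i, vs ! (Suc i mod ?n)}"
    then obtain i where i: "i < ?n" "e = {vs ! i, vs ! (Suc i mod ?n)}" by blast
    \<comment> \<open>This is \<open>i - k\<close> modulo the length; adding the length first keeps
      natural-number subtraction from truncating.\<close>
    define j where "j = (i + (?n - k mod ?n)) mod ?n"
    have "(k + j) mod ?n = (k mod ?n + (i + (?n - k mod ?n))) mod ?n"
      unfolding j_def by (simp add: mod_simps)
    also have "k mod ?n + (i + (?n - k mod ?n)) = i + ?n"
      using mod_less_divisor[OF n, of k] by simp
    finally have kj: "(k + j) mod ?n = i" using i by simp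
    have jn: "j < ?n" unfolding j_def using n by simp
    have "(k + Suc j mod ?n) mod ?n = Suc ((k + j) mod ?n) mod ?n" by (simp add: mod_simps)
    then have "e = {rotate k vs ! j, rotate k vs ! (Suc j mod ?n)}"
      using i n jn kj by (simp add: nth_rotate)
    then show "\<exists>i<?n. e = {rotate k vs ! i, rotate k vs ! (Suc i mod ?n)}" using jn by blast
  qed
  then have "{{rotate k vs ! i, rotate k vs ! (Suc i mod ?n)} | i. i < ?n} =
      {{vs ! i, vs ! (Suc i mod ?n)} | i. i < ?n}" by (simp add: conj_commute)
  then show ?thesis by (simp add: cycle_graph_def)
qed simp

lemma edge_of_hole_subset: "C \<in> holes G \<Longrightarrow> f \<in> edges C \<Longrightarrow> f \<subseteq> verts C"
  by (auto simp: holes_def is_cycle_def cycle_graph_def intro!: nth_mem mod_less_divisor)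

lemma holes_induced_subgraph:
  assumes "D \<in> holes (induced_subgraph G S)"
  shows "D \<in> holes G" "verts D \<subseteq> S"
proof -
  have "chordless G D" unfolding chordless_def
  proof (intro ballI impI)
    fix e assume "e \<in> edges G" "e \<subseteq> verts D"
    then show "e \<in> edges D" using assms
      by (auto simp: holes_def is_cycle_def chordless_def induced_subgraph_def)
  qed
  then show "D \<in> holes G" "verts D \<subseteq> S" using assms
    by (auto simp: holes_def is_cycle_def induced_subgraph_def)
qed

lemma delete_verts_twice:
  "delete_verts (delete_verts G X) Y = induced_subgraph G (verts G - X - Y)"
  by (auto simp: delete_verts_def induced_subgraph_def)

section \<open>Reachability inside a vertex set, induced paths and components\<close>

locale fin_graph =
  fixes G :: "'a graph"
  assumes finite_simple: "finite_simple_graph G"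
begin

abbreviation adj :: "'a \<Rightarrow> 'a \<Rightarrow> bool" where
  "adj x y \<equiv> {x, y} \<in> edges G"

lemma adj_sym: "adj x y \<Longrightarrow> adj y x"
  by (simp add: insert_commute)

lemma adj_irrefl [simp]: "{x} \<notin> edges G"
  using finite_simple by (auto simp: finite_simple_graph_def)

lemma adj_in_verts: "adj x y \<Longrightarrow> x \<in> verts G \<and> y \<in> verts G"
  using finite_simple by (fastforce simp: finite_simple_graph_def doubleton_eq_iff)

lemma edge_cases:
  assumes "e \<in> edges G"
  obtains x y where "e = {x, y}" "x \<noteq> y" "adj x y"
  using finite_simple assms unfolding finite_simple_graph_def by metis

text \<open>A closure is used instead of lists so that walks can be joined, reversed and inducted
  on. It is reflexive even outside \<open>A\<close>, hence the membership premises of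
  \<open>reach_in\<close> and \<open>reach_ipath\<close>.\<close>

definition reach :: "'a set \<Rightarrow> 'a \<Rightarrow> 'a \<Rightarrow> bool" where
  "reach A = (\<lambda>x y. x \<in> A \<and> y \<in> A \<and> adj x y)\<^sup>*\<^sup>*"

lemma reach_refl [simp]: "reach A x x"
  by (simp add: reach_def)

lemma reach_trans: "reach A x y \<Longrightarrow> reach A y z \<Longrightarrow> reach A x z"
  by (simp add: reach_def)

lemma reach_step: "x \<in> A \<Longrightarrow> y \<in> A \<Longrightarrow> adj x y \<Longrightarrow> reach A x y"
  by (auto simp: reach_def)

lemma reach_sym: "reach A x y \<Longrightarrow> reach A y x"
  unfolding reach_def
  by (rule sympD[OF symp_rtranclp]) (auto simp: symp_def insert_commute)

lemma reach_mono: "reach A x y \<Longrightarrow> A \<subseteq> B \<Longrightarrow> reach B x y"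
  unfolding reach_def by (rule rtranclp_mono[THEN predicate2D, rotated]) auto

lemma reach_in: "reach A x y \<Longrightarrow> x \<in> A \<Longrightarrow> y \<in> A"
  unfolding reach_def by (induction rule: rtranclp_induct) auto

lemma reach_induct [consumes 1, case_names refl step]:
  assumes "reach A x y" "P x"
    "\<And>y z. reach A x y \<Longrightarrow> y \<in> A \<Longrightarrow> z \<in> A \<Longrightarrow> adj y z \<Longrightarrow> P y \<Longrightarrow> P z"
  shows "P y"
  using assms unfolding reach_def by (induction rule: rtranclp_induct) blast+

text \<open>The equivalence, rather than an implication as in \<open>is_path\<close>, forbids
  chords: these are the induced paths.\<close>

definition ipath :: "'a list \<Rightarrow> bool" where
  "ipath p \<longleftrightarrow> p \<noteq> [] \<and> distinct p \<and> set p \<subseteq> verts G \<and>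
     (\<forall>i<length p. \<forall>j<length p. adj (p ! i) (p ! j) \<longleftrightarrow> j = Suc i \<or> i = Suc j)"

lemma ipath_take: "ipath p \<Longrightarrow> ipath (take (Suc i) p)"
  unfolding ipath_def by (auto dest: in_set_takeD)

lemma ipath_snoc:
  assumes "ipath p" "z \<in> verts G" "z \<notin> set p" "adj (last p) z"
    "\<And>i. Suc i < length p \<Longrightarrow> \<not> adj (p ! i) z"
  shows "ipath (p @ [z])"
proof -
  have p: "p \<noteq> []" using assms(1) by (simp add: ipath_def)
  have l: "adj (p ! i) z \<longleftrightarrow> Suc i = length p" if "i < length p" for i
    using assms(4,5) that p by (metis Suc_lessI diff_Suc_1 last_conv_nth)
  have l': "adj z (p ! i) \<longleftrightarrow> Suc i = length p" if "i < length p" for i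
    using l[OF that] by (simp add: insert_commute)
  show ?thesis
    using assms(1-3) unfolding ipath_def by (auto simp: nth_append l l' less_Suc_eq)
qed

text \<open>The walk is followed step by step. If the new vertex \<open>z\<close> is already on the
  path, the path is cut there; otherwise it is cut at its first neighbour of \<open>z\<close>, so
  that appending \<open>z\<close> creates no chord.\<close>

lemma reach_ipath:
  assumes "reach A x y" "x \<in> A" "x \<in> verts G"
  shows "\<exists>p. ipath p \<and> set p \<subseteq> A \<and> hd p = x \<and> last p = y"
  using assms(1)
proof (induction rule: reach_induct)
  case refl
  have "ipath [x]" using assms by (simp add: ipath_def)
  then show ?case using assms by (metis empty_set last_ConsL list.sel(1) list.simps(15) empty_subsetI insert_subset)
next
  case (step y z)
  then obtain p where p: "ipath p" "set p \<subseteq> A" "hd p = x" "last p = y" by blast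
  have ne: "p \<noteq> []" using p by (simp add: ipath_def)
  have sub: "set (take k p) \<subseteq> A" for k using p(2) set_take_subset by fastforce
  show ?case
  proof (cases "z \<in> set p")
    case True
    then obtain k where k: "k < length p" "p ! k = z" by (meson in_set_conv_nth)
    have "hd (take (Suc k) p) = x" using p ne by (simp add: hd_take)
    then show ?thesis using ipath_take[OF p(1)] sub last_take_Suc[OF k(1)] k(2) by blast
  next
    case False
    define i where "i = (LEAST i. adj (p ! i) z)"
    have ex: "adj (p ! (length p - 1)) z" using step p ne by (simp add: last_conv_nth)
    have i: "adj (p ! i) z" unfolding i_def by (rule LeastI[of _ "length p - 1"]) (rule ex)
    have il: "i < length p"
      using Least_le[of "\<lambda>i. adj (p ! i) z", OF ex] ne unfolding i_def[symmetric]
      by (cases p) auto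
    have nb: "\<not> adj (p ! j) z" if "j < i" for j using not_less_Least that unfolding i_def by blast
    have "ipath (take (Suc i) p @ [z])"
    proof (rule ipath_snoc[OF ipath_take[OF p(1)]])
      show "z \<in> verts G" using step adj_in_verts by blast
      show "z \<notin> set (take (Suc i) p)" using False by (auto dest: in_set_takeD)
      show "adj (last (take (Suc i) p)) z" using i il by (simp add: last_take_Suc)
      show "\<not> adj (take (Suc i) p ! j) z" if "Suc j < length (take (Suc i) p)" for j
        using that nb by simp
    qed
    moreover have "hd (take (Suc i) p @ [z]) = x" using p ne by simp
    moreover have "set (take (Suc i) p @ [z]) \<subseteq> A" using sub step by simp
    ultimately show ?thesis by (metis last_snoc)
  qed
qed

lemma ipath_is_path: "ipath p \<Longrightarrow> is_path G p"
  by (auto simp: ipath_def is_path_def)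

lemma reach_chain:
  assumes "i \<le> j" "\<And>m. i \<le> m \<Longrightarrow> m < j \<Longrightarrow> adj (p ! m) (p ! Suc m)"
    "\<And>m. i \<le> m \<Longrightarrow> m \<le> j \<Longrightarrow> p ! m \<in> A"
  shows "reach A (p ! i) (p ! j)"
  using assms
proof (induction j rule: dec_induct)
  case (step n)
  then have "reach A (p ! n) (p ! Suc n)" by (intro reach_step) auto
  moreover have "reach A (p ! i) (p ! n)" using step by auto
  ultimately show ?case by (rule reach_trans[rotated])
qed simp

text \<open>The bridge from components, defined by lists, to \<open>reach\<close>; an induced path
  supplies the list for the converse.\<close>

lemma component_of_induced:
  assumes "v \<in> A" "A \<subseteq> verts G"
  shows "component_of (induced_subgraph G A) v = {w. reach A v w}"
proof (intro set_eqI iffI; clarsimp simp: component_of_def)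
  fix p assume p: "is_path (induced_subgraph G A) p" "v = hd p"
  then have "p ! m \<in> A" if "m \<le> length p - 1" for m
    using that nth_mem[of m p] by (cases p) (auto simp: is_path_def induced_subgraph_def)
  with p have "reach A (p ! 0) (p ! (length p - 1))"
    by (intro reach_chain) (auto simp: is_path_def induced_subgraph_def)
  then show "reach A (hd p) (last p)"
    using p by (simp add: is_path_def hd_conv_nth last_conv_nth)
next
  fix w assume "reach A v w"
  then obtain p where p: "ipath p" "set p \<subseteq> A" "hd p = v" "last p = w"
    using reach_ipath assms by blast
  then have "is_path (induced_subgraph G A) p"
    using ipath_is_path[OF p(1)] by (auto simp: is_path_def induced_subgraph_def subset_iff)
  then show "\<exists>p. is_path (induced_subgraph G A) p \<and> hd p = v \<and> last p = w" using p by blast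
qed

lemma component_of_eq: "v \<in> verts G \<Longrightarrow> component_of G v = {w. reach (verts G) v w}"
proof -
  have "e \<subseteq> verts G" if "e \<in> edges G" for e
    using that by (rule edge_cases) (use adj_in_verts in blast)
  then have "induced_subgraph G (verts G) = G"
    by (cases G) (auto simp: induced_subgraph_def)
  then show "v \<in> verts G \<Longrightarrow> ?thesis" using component_of_induced[of v "verts G"] by simp
qed

lemma components_induced:
  assumes "A \<subseteq> verts G"
  shows "components (induced_subgraph G A) = (\<lambda>v. {w. reach A v w}) ` A"
  using assms component_of_induced unfolding components_def
  by (auto simp: induced_subgraph_def Int_absorb1)

lemma reach_class_eq: "reach A x y \<Longrightarrow> {w. reach A x w} = {w. reach A y w}"
  using reach_sym reach_trans by blast

section \<open>Holes as an apex closing an induced path\<close>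

text \<open>The apex \<open>y\<close> sees only the two ends of \<open>r\<close>, so closing
  \<open>r\<close> through \<open>y\<close> creates no chord, and three vertices on \<open>r\<close>
  already yield four edges.\<close>

lemma hole_intro:
  assumes "ipath r" "length r \<ge> 3" "y \<notin> set r" "y \<in> verts G"
    "\<And>i. i < length r \<Longrightarrow> adj y (r ! i) \<longleftrightarrow> i = 0 \<or> Suc i = length r"
  shows "cycle_graph (y # r) \<in> holes G"
proof -
  have ne: "r \<noteq> []" using assms by auto
  note E = edges_cycle_graph_Cons[OF ne, of y]
  have d: "distinct r" and ra: "\<And>i j. i < length r \<Longrightarrow> j < length r \<Longrightarrow> adj (r ! i) (r ! j) \<longleftrightarrow> j = Suc i \<or> i = Suc j"
    and sub: "set r \<subseteq> verts G" using assms(1) by (auto simp: ipath_def)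
  have h: "hd r = r ! 0" and l: "last r = r ! (length r - 1)"
    using ne by (auto simp: hd_conv_nth last_conv_nth)
  have ya: "adj y (r ! 0)" "adj y (r ! (length r - 1))"
    using assms(2) assms(5)[of 0] assms(5)[of "length r - 1"] ne by simp_all
  have "edges (cycle_graph (y # r)) \<subseteq> edges G"
    using ra ya by (auto simp: E h l)
  then have cyc: "is_cycle G (cycle_graph (y # r))"
    unfolding is_cycle_def using assms d sub by (auto intro!: exI[of _ "y # r"])
  have key: "{a, b} \<in> edges (cycle_graph (y # r))"
    if ab: "adj a b" "a \<in> set (y # r)" "b \<in> set (y # r)" for a b
  proof -
    have yr: "{y, c} \<in> edges (cycle_graph (y # r))" if c: "adj y c" "c \<in> set r" for c
    proof -
      obtain i where i: "i < length r" "r ! i = c" using c(2) by (meson in_set_conv_nth)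
      then have "i = 0 \<or> i = length r - 1" using assms(5)[OF i(1)] c(1) by auto
      then show ?thesis using i by (auto simp: E h l)
    qed
    show ?thesis
    proof (cases "a = y \<or> b = y")
      case True
      then show ?thesis using ab yr by (auto simp: insert_commute)
    next
      case False
      then obtain i j where ij: "i < length r" "r ! i = a" "j < length r" "r ! j = b"
        using ab by (metis in_set_conv_nth set_ConsD)
      then have "j = Suc i \<or> i = Suc j" using ra ab by blast
      then show ?thesis using ij unfolding E by (auto simp: insert_commute)
    qed
  qed
  have "e \<in> edges (cycle_graph (y # r))" if "e \<in> edges G" "e \<subseteq> set (y # r)" for e
    using that(1) by (rule edge_cases) (use that key in auto)
  then have ch: "chordless G (cycle_graph (y # r))"
    unfolding chordless_def by simp
  have fin: "finite (edges (cycle_graph (y # r)))"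
    by (simp add: cycle_graph_def)
  \<comment> \<open>Four distinct edges are enough for the cardinality bound. In the shortest case
    \<open>last r\<close> is \<open>r ! 2\<close>, and these four sets still differ.\<close>
  let ?F = "{{y, r ! 0}, {r ! 0, r ! 1}, {r ! 1, r ! 2}, {y, last r}}"
  have neqs: "r ! 0 \<noteq> r ! 1" "r ! 0 \<noteq> r ! 2" "r ! 1 \<noteq> r ! 2" "last r \<noteq> r ! 0" "last r \<noteq> r ! 1"
    "y \<noteq> r ! 0" "y \<noteq> r ! 1" "y \<noteq> r ! 2" "y \<noteq> last r"
    using nth_eq_iff_index_eq[OF d, of 0 1] nth_eq_iff_index_eq[OF d, of 0 2]
      nth_eq_iff_index_eq[OF d, of 1 2] nth_eq_iff_index_eq[OF d, of "length r - 1" 0]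
      nth_eq_iff_index_eq[OF d, of "length r - 1" 1]
      nth_mem[of 0 r] nth_mem[of 1 r] nth_mem[of 2 r] nth_mem[of "length r - 1" r] assms(2,3) ne
    unfolding l by auto
  have "{r ! 0, r ! 1} \<in> edges (cycle_graph (y # r))" "{r ! 1, r ! 2} \<in> edges (cycle_graph (y # r))"
    using assms(2) unfolding E numeral_2_eq_2 One_nat_def by auto
  then have "?F \<subseteq> edges (cycle_graph (y # r))"
    by (auto simp: E h)
  then have "card ?F \<le> card (edges (cycle_graph (y # r)))" by (rule card_mono[OF fin])
  moreover have "card ?F = 4" using neqs by (auto simp: doubleton_eq_iff)
  ultimately show ?thesis using cyc ch by (simp add: holes_def)
qed

lemma hole_adj_iff:
  assumes "C \<in> holes G" "x \<in> verts C" "y \<in> verts C"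
  shows "adj x y \<longleftrightarrow> {x, y} \<in> edges C"
  using assms by (auto simp: holes_def is_cycle_def chordless_def)

text \<open>The converse of \<open>hole_intro\<close>, with any vertex of the hole as apex.
  Positions on the hole become indices into the induced path \<open>r\<close>, free of modular
  arithmetic.\<close>

lemma hole_at:
  assumes C: "C \<in> holes G" and y: "y \<in> verts C"
  obtains r where "C = cycle_graph (y # r)" "ipath r" "length r \<ge> 3" "y \<notin> set r"
    "\<And>i. i < length r \<Longrightarrow> adj y (r ! i) \<longleftrightarrow> i = 0 \<or> Suc i = length r"
proof -
  obtain vs where vs: "distinct vs" "C = cycle_graph vs"
    using C by (auto simp: holes_def is_cycle_def)
  have "edges C = (\<lambda>i. {vs ! i, vs ! (Suc i mod length vs)}) ` {..<length vs}"
    by (auto simp: vs cycle_graph_def)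
  then have "card (edges C) \<le> length vs" by (metis card_image_le card_lessThan finite_lessThan)
  then have len: "length vs \<ge> 4" using C by (simp add: holes_def)
  obtain k where k: "k < length vs" "vs ! k = y" using y vs by (auto simp: in_set_conv_nth)
  have "hd (rotate k vs) = y" using k len by (subst hd_rotate_conv_nth) auto
  moreover have "rotate k vs \<noteq> []" using len by auto
  ultimately obtain r where r: "rotate k vs = y # r" by (metis list.collapse)
  have Cr: "C = cycle_graph (y # r)" using vs cycle_graph_rotate r by metis
  have dy: "distinct (y # r)" using vs(1) r by (metis distinct_rotate)
  have lr: "length r \<ge> 3" using len r length_rotate[of k vs] by simp
  then have ne: "r \<noteq> []" by auto
  note E = edges_cycle_graph_Cons[OF ne, of y]
  have h: "hd r = r ! 0" and l: "last r = r ! (length r - 1)"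
    using ne by (auto simp: hd_conv_nth last_conv_nth)
  have sub: "set (y # r) \<subseteq> verts G" using C Cr by (auto simp: holes_def is_cycle_def)
  have ra: "adj (r ! i) (r ! j) \<longleftrightarrow> j = Suc i \<or> i = Suc j" if "i < length r" "j < length r" for i j
  proof -
    have yn: "y \<noteq> r ! m" if "m < length r" for m using dy that by auto
    have "adj (r ! i) (r ! j) \<longleftrightarrow> {r ! i, r ! j} \<in> edges (cycle_graph (y # r))"
      using hole_adj_iff[OF C] that Cr by simp
    also have "\<dots> \<longleftrightarrow> j = Suc i \<or> i = Suc j"
      using dy that yn[OF that(1)] yn[OF that(2)] unfolding E
      by (auto simp: doubleton_eq_iff nth_eq_iff_index_eq)
    finally show ?thesis .
  qed
  have ya: "adj y (r ! i) \<longleftrightarrow> i = 0 \<or> Suc i = length r" if "i < length r" for i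
  proof -
    have yn: "y \<noteq> r ! m" if "m < length r" for m using dy that by auto
    have "adj y (r ! i) \<longleftrightarrow> {y, r ! i} \<in> edges (cycle_graph (y # r))"
      using hole_adj_iff[OF C] that Cr by simp
    also have "\<dots> \<longleftrightarrow> i = 0 \<or> Suc i = length r"
      using dy that ne yn unfolding E h l
      by (auto simp: doubleton_eq_iff nth_eq_iff_index_eq)
    finally show ?thesis .
  qed
  have "ipath r" unfolding ipath_def using ne dy sub ra by simp
  then show thesis using that Cr lr dy ya by simp
qed

text \<open>An induced path in \<open>A\<close> from \<open>z\<close> to \<open>w\<close> is cut at
  the next neighbour of \<open>y\<close> after \<open>z\<close>. As \<open>y\<close> and
  \<open>z\<close> have no common neighbour in \<open>A\<close>, closing it through \<open>y\<close>
  gives no triangle but a hole through the prescribed edge, which edge-disjointness can then be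
  applied to.\<close>

lemma hole_through_edge:
  assumes "y \<notin> A" "z \<in> A" "w \<in> A" "w \<noteq> z" "adj y z" "adj y w" "reach A z w"
    and common: "\<And>k. k \<in> A \<Longrightarrow> adj y k \<Longrightarrow> adj z k \<Longrightarrow> False"
  shows "\<exists>D\<in>holes G. {y, z} \<in> edges D \<and> verts D \<subseteq> insert y A"
proof -
  have zy: "z \<in> verts G" "y \<in> verts G" using assms adj_in_verts by blast+
  obtain p where p: "ipath p" "set p \<subseteq> A" "hd p = z" "last p = w"
    using reach_ipath assms zy by blast
  have ne: "p \<noteq> []" using p by (simp add: ipath_def)
  have p0: "p ! 0 = z" using p ne by (simp add: hd_conv_nth)
  \<comment> \<open>Index 0 is excluded because \<open>p ! 0\<close> is \<open>z\<close>, itself a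
    neighbour of \<open>y\<close>.\<close>
  let ?P = "\<lambda>i. i > 0 \<and> adj y (p ! i)"
  define i where "i = (LEAST i. ?P i)"
  have "length p \<noteq> 1" using p assms ne by (auto simp: length_Suc_conv)
  then have ex: "?P (length p - 1)" using assms p ne by (cases p) (auto simp: last_conv_nth)
  have i: "?P i" unfolding i_def by (rule LeastI[of ?P, OF ex])
  have "i \<le> length p - 1" unfolding i_def by (rule Least_le[of ?P, OF ex])
  then have il: "i < length p" using ne by (cases p) auto
  have nb: "\<not> ?P j" if "j < i" for j using not_less_Least that unfolding i_def by blast
  have "i \<noteq> 1"
  proof
    assume "i = 1"
    then have "adj z (p ! i)" using p(1) il ne p0 unfolding ipath_def by fastforce
    then show False using common[of "p ! i"] i il p(2) nth_mem by blast
  qed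
  then have i2: "i \<ge> 2" using i by simp
  let ?r = "take (Suc i) p"
  have "cycle_graph (y # ?r) \<in> holes G"
  proof (rule hole_intro[OF ipath_take[OF p(1)]])
    show "3 \<le> length ?r" using i2 il by simp
    show "y \<notin> set ?r" using p(2) assms(1) by (auto dest: in_set_takeD)
    show "adj y (?r ! j) \<longleftrightarrow> j = 0 \<or> Suc j = length ?r" if "j < length ?r" for j
      using that il nb[of j] i p0 assms(5) by (cases "j = 0"; cases "j = i") auto
  qed (use zy in simp)
  moreover have "hd ?r = z" using p ne by (simp add: hd_take)
  then have "{y, z} \<in> edges (cycle_graph (y # ?r))"
    using ne by (subst edges_cycle_graph_Cons) auto
  moreover have "verts (cycle_graph (y # ?r)) \<subseteq> insert y A"
    using p(2) by (auto dest: in_set_takeD)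
  ultimately show ?thesis by blast
qed

text \<open>Connected sets grown by one vertex at a time: the induction in
  \<open>attachments_adj\<close> needs what is left after removing the last vertex to be connected
  again.\<close>

inductive conn :: "'a set \<Rightarrow> bool" where
  singleton: "conn {x}"
| extend: "conn K \<Longrightarrow> k \<in> K \<Longrightarrow> adj x k \<Longrightarrow> conn (insert x K)"

lemma conn_reach: "conn K \<Longrightarrow> x \<in> K \<Longrightarrow> y \<in> K \<Longrightarrow> reach K x y"
proof (induction arbitrary: x y rule: conn.induct)
  case (extend K k z)
  have a: "reach (insert z K) a b" if "a \<in> K" "b \<in> K" for a b
    using extend.IH[OF that] reach_mono by blast
  have b: "reach (insert z K) z k" using extend.hyps by (intro reach_step) auto
  have c: "reach (insert z K) z a" if "a \<in> insert z K" for a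
    using that a[OF extend.hyps(2)] reach_trans[OF b] by auto
  show ?case using c[OF extend.prems(1)] c[OF extend.prems(2)] reach_sym reach_trans by blast
qed simp

lemma reach_conn:
  assumes "reach A x y" "x \<in> A"
  shows "\<exists>K\<subseteq>A. conn K \<and> x \<in> K \<and> y \<in> K"
  using assms(1)
proof (induction rule: reach_induct)
  case refl
  then show ?case using assms(2) by (intro exI[of _ "{x}"]) (auto intro: conn.intros)
next
  case (step y z)
  then obtain K where "K \<subseteq> A" "conn K" "x \<in> K" "y \<in> K" by blast
  with step show ?case
    by (intro exI[of _ "insert z K"]) (auto intro!: conn.extend[of K y] simp: insert_commute)
qed

section \<open>Shape of a single hole\<close>

text \<open>Seen from \<open>u\<close>, its neighbours on the hole are the two ends of an induced
  path with at least three vertices, and these ends are not adjacent.\<close>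

lemma no_triangle:
  assumes C: "C \<in> holes G" and "u \<in> verts C" "v \<in> verts C" "w \<in> verts C" "adj u v" "adj u w"
  shows "\<not> adj v w"
proof
  assume vw: "adj v w"
  obtain r where r: "C = cycle_graph (u # r)" "ipath r" "length r \<ge> 3" "u \<notin> set r"
    "\<And>i. i < length r \<Longrightarrow> adj u (r ! i) \<longleftrightarrow> i = 0 \<or> Suc i = length r"
    using hole_at[OF C assms(2)] by blast
  have ne: "v \<noteq> u" "w \<noteq> u" using assms by auto
  then have "v \<in> set r" "w \<in> set r" using assms(3,4) r(1) by auto
  then obtain i j where i: "i < length r" "r ! i = v" and j: "j < length r" "r ! j = w"
    by (auto simp: in_set_conv_nth)
  have "j = Suc i \<or> i = Suc j" using r(2) i j vw unfolding ipath_def by blast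
  moreover have "i = 0 \<or> Suc i = length r" "j = 0 \<or> Suc j = length r"
    using r(5)[OF i(1)] r(5)[OF j(1)] i j assms by auto
  ultimately show False using r(3) by auto
qed

lemma hole_nonempty: "C \<in> holes G \<Longrightarrow> verts C \<noteq> {}"
  by (auto simp: holes_def is_cycle_def)

text \<open>Nothing is claimed about adjacency of \<open>a\<close> and \<open>d\<close>, which holds
  exactly in holes of length 4.\<close>

lemma hole_consecutive:
  assumes C: "C \<in> holes G"
  obtains a b c d where "{a, b, c, d} \<subseteq> verts C" "adj a b" "adj b c" "adj c d"
    "a \<noteq> c" "\<not> adj a c" "b \<noteq> d" "\<not> adj b d" "a \<noteq> d"
proof -
  obtain y where y: "y \<in> verts C" using hole_nonempty[OF C] by blast
  obtain r where r: "C = cycle_graph (y # r)" "ipath r" "length r \<ge> 3" "y \<notin> set r"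
    "\<And>i. i < length r \<Longrightarrow> adj y (r ! i) \<longleftrightarrow> i = 0 \<or> Suc i = length r"
    using hole_at[OF C y] by blast
  obtain a b c s where s: "r = a # b # c # s"
    using r(3) by (metis Suc_le_length_iff numeral_3_eq_3)
  have "adj (r ! 0) (r ! 1)" "adj (r ! 1) (r ! 2)" "\<not> adj (r ! 0) (r ! 2)" "distinct r"
    using r(2,3) unfolding ipath_def by auto
  then show thesis using that[of y a b c] r(1,4) r(5)[of 0] r(5)[of 1] by (auto simp: s)
qed

lemma hole_not_clique:
  assumes "C \<in> holes G"
  obtains a b where "a \<in> verts C" "b \<in> verts C" "a \<noteq> b" "\<not> adj a b"
  using hole_consecutive[OF assms] by (metis insert_subset)

lemma hole_not_covered:
  assumes "C \<in> holes G"
  shows "\<not> verts C \<subseteq> {x, y, z}"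
proof
  assume "verts C \<subseteq> {x, y, z}"
  obtain a b c d where *: "{a, b, c, d} \<subseteq> verts C" "adj a b" "adj b c" "adj c d"
    "a \<noteq> c" "\<not> adj a c" "b \<noteq> d" "\<not> adj b d" "a \<noteq> d" by (rule hole_consecutive[OF assms])
  then have "a \<noteq> b" "b \<noteq> c" "c \<noteq> d" by auto
  then have "card {a, b, c, d} = 4" using * by simp
  moreover have "card {a, b, c, d} \<le> card {x, y, z}"
    using * \<open>verts C \<subseteq> {x, y, z}\<close> by (intro card_mono) auto
  moreover have "card {x, y, z} \<le> 3" by (simp add: card_insert_if)
  ultimately show False by simp
qed

lemma finite_edges: "finite (edges G)"
proof -
  have "edges G \<subseteq> Pow (verts G)" using finite_simple by (auto simp: finite_simple_graph_def)
  then show ?thesis using finite_simple by (auto simp: finite_simple_graph_def intro: finite_subset)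
qed

lemma finite_holes: "finite (holes G)"
proof -
  have "D \<in> (\<lambda>(V, E). Graph V E) ` (Pow (verts G) \<times> Pow (edges G))" if "D \<in> holes G" for D
    using that by (intro image_eqI[of _ _ "(verts D, edges D)"]) (auto simp: holes_def is_cycle_def)
  then have "holes G \<subseteq> (\<lambda>(V, E). Graph V E) ` (Pow (verts G) \<times> Pow (edges G))" by blast
  then show ?thesis
    using finite_simple finite_edges by (auto simp: finite_simple_graph_def intro: finite_subset)
qed

lemma hole_connected:
  assumes C: "C \<in> holes G" and ab: "a \<in> verts C" "b \<in> verts C"
  shows "reach (verts C) a b"
proof (cases "b = a")
  case False
  obtain r where r: "C = cycle_graph (a # r)" "ipath r" "length r \<ge> 3" "a \<notin> set r"
    "\<And>i. i < length r \<Longrightarrow> adj a (r ! i) \<longleftrightarrow> i = 0 \<or> Suc i = length r"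
    using hole_at[OF C ab(1)] by blast
  obtain i where i: "i < length r" "r ! i = b" using False ab(2) r(1) by (auto simp: in_set_conv_nth)
  have "adj a (r ! 0)" using r(5)[of 0] r(3) by fastforce
  moreover have "r ! 0 \<in> set r" using r(3) by (intro nth_mem) linarith
  ultimately have "reach (verts C) a (r ! 0)" using r(1) by (intro reach_step) auto
  moreover have "reach (verts C) (r ! 0) (r ! i)"
    by (rule reach_chain) (use r(1,2) i in \<open>auto simp: ipath_def\<close>)
  ultimately show ?thesis using i reach_trans by blast
qed simp

text \<open>Seen from \<open>u\<close>, the vertex \<open>v\<close> is an end of the path
  \<open>r\<close>, so deleting both leaves a contiguous stretch of \<open>r\<close>.\<close>

lemma hole_minus_edge_connected:
  assumes C: "C \<in> holes G" and uv: "{u, v} \<in> edges C"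
    and ab: "a \<in> verts C - {u, v}" "b \<in> verts C - {u, v}"
  shows "reach (verts C - {u, v}) a b"
proof -
  have uC: "u \<in> verts C" "v \<in> verts C" using edge_of_hole_subset[OF C uv] by auto
  have "adj u v" using hole_adj_iff[OF C uC] uv by simp
  obtain r where r: "C = cycle_graph (u # r)" "ipath r" "length r \<ge> 3" "u \<notin> set r"
    "\<And>i. i < length r \<Longrightarrow> adj u (r ! i) \<longleftrightarrow> i = 0 \<or> Suc i = length r"
    using hole_at[OF C uC(1)] by blast
  have "v \<noteq> u" using \<open>adj u v\<close> by auto
  then obtain m where m: "m < length r" "r ! m = v" using uC(2) r(1) by (auto simp: in_set_conv_nth)
  then have m': "m = 0 \<or> Suc m = length r" using r(5)[OF m(1)] \<open>adj u v\<close> by simp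
  have d: "distinct r" using r(2) by (simp add: ipath_def)
  have seg: "reach (verts C - {u, v}) (r ! i) (r ! j)"
    if ij: "i \<le> j" "j < length r" "i \<noteq> m" "j \<noteq> m" for i j
  proof (rule reach_chain)
    show "adj (r ! k) (r ! Suc k)" if "i \<le> k" "k < j" for k
      using r(2) that ij unfolding ipath_def by auto
    show "r ! k \<in> verts C - {u, v}" if k: "i \<le> k" "k \<le> j" for k
    proof -
      \<comment> \<open>An end index such as \<open>m\<close> cannot lie between two indices
        different from it.\<close>
      have "k \<noteq> m" using m' k ij by auto
      then have "r ! k \<noteq> v" using d k ij m by (auto simp: nth_eq_iff_index_eq)
      moreover have "r ! k \<in> set r" using k ij by simp
      ultimately show ?thesis using r(1,4) by auto
    qed
  qed (rule ij)
  obtain i j where i: "i < length r" "r ! i = a" and j: "j < length r" "r ! j = b"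
    using ab r(1) by (auto simp: in_set_conv_nth)
  have "i \<noteq> m" "j \<noteq> m" using i j m ab by auto
  then show ?thesis using seg[of i j] seg[of j i] i j reach_sym by (metis nat_le_linear)
qed

end

section \<open>Attachments to a hole\<close>

locale hole_edge_disjoint_graph = fin_graph +
  assumes disjoint: "hole_edge_disjoint G"
begin

lemma hole_unique: "C \<in> holes G \<Longrightarrow> D \<in> holes G \<Longrightarrow> f \<in> edges C \<Longrightarrow> f \<in> edges D \<Longrightarrow> D = C"
  using disjoint unfolding hole_edge_disjoint_def by blast

text \<open>The vertex \<open>y\<close> without neighbours in \<open>K\<close> serves as apex, so
  the possible attachments of \<open>K\<close> are linearly ordered along \<open>r\<close>.\<close>

lemma attachment_indices:
  assumes C: "C \<in> holes G" and r: "C = cycle_graph (y # r)" "ipath r" "length r \<ge> 3" "y \<notin> set r"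
    "\<And>i. i < length r \<Longrightarrow> adj y (r ! i) \<longleftrightarrow> i = 0 \<or> Suc i = length r"
    and K: "conn K" "K \<inter> verts C = {}" "\<And>k. k \<in> K \<Longrightarrow> \<not> adj y k"
    and ij: "i < j" "j < length r" "k \<in> K" "adj (r ! i) k" "l \<in> K" "adj (r ! j) l"
  shows "j = Suc i"
proof (rule ccontr)
  assume "j \<noteq> Suc i"
  with ij have j: "Suc i < j" by simp
  \<comment> \<open>Rerouting \<open>C\<close> through \<open>K\<close> gives a hole with the edge from \<open>y\<close> to \<open>r ! 0\<close> that misses \<open>r ! Suc i\<close>.\<close>
  let ?A = "set (take (Suc i) r) \<union> K \<union> set (drop j r)"
  have d: "distinct r" and ra: "\<And>a b. a < length r \<Longrightarrow> b < length r \<Longrightarrow> adj (r ! a) (r ! b) \<longleftrightarrow> b = Suc a \<or> a = Suc b"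
    using r(2) unfolding ipath_def by auto
  have in1: "r ! a \<in> ?A" if "a \<le> i" for a
    using that ij by (auto simp: in_set_conv_nth intro!: exI[of _ a])
  have in2: "r ! a \<in> ?A" if "j \<le> a" "a < length r" for a
    using that ij by (auto simp: in_set_conv_nth intro!: exI[of _ "a - j"])
  have 1: "reach ?A (r ! 0) (r ! i)"
    by (rule reach_chain) (use ij ra in1 in auto)
  have 2: "reach ?A (r ! i) k" using ij in1[of i] by (intro reach_step) auto
  have 3: "reach ?A k l" by (rule reach_mono[OF conn_reach[OF K(1)]]) (use ij in auto)
  have 4: "reach ?A l (r ! j)" using ij in2[of j] by (intro reach_step) (auto simp: insert_commute)
  have 5: "reach ?A (r ! j) (r ! (length r - 1))"
    by (rule reach_chain) (use ij ra in2 in auto)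
  have reach: "reach ?A (r ! 0) (r ! (length r - 1))"
    using 1 2 3 4 5 reach_trans by blast
  have "\<exists>D\<in>holes G. {y, r ! 0} \<in> edges D \<and> verts D \<subseteq> insert y ?A"
  proof (rule hole_through_edge[OF _ _ _ _ _ _ reach])
    show "y \<notin> ?A" using r K(2) by (auto dest: in_set_takeD in_set_dropD)
    show "r ! 0 \<in> ?A" "r ! (length r - 1) \<in> ?A" using in1 in2[of "length r - 1"] ij by auto
    show "r ! (length r - 1) \<noteq> r ! 0" using d r(3) by (subst nth_eq_iff_index_eq) auto
    show "adj y (r ! 0)" "adj y (r ! (length r - 1))"
      using r(5)[of 0] r(5)[of "length r - 1"] r(3) ij by fastforce+
    fix m assume m: "m \<in> ?A" "adj y m" "adj (r ! 0) m"
    \<comment> \<open>A common neighbour of \<open>y\<close> and \<open>r ! 0\<close> cannot lie in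
      \<open>K\<close>. On \<open>r\<close> it would be an end, as a neighbour of \<open>y\<close>,
      and also \<open>r ! 1\<close>, which is not an end.\<close>
    then have "m \<in> set r" using K(3) by (auto dest: in_set_takeD in_set_dropD)
    then obtain a where a: "a < length r" "r ! a = m" by (auto simp: in_set_conv_nth)
    then have "a = 0 \<or> Suc a = length r" using m r(5)[OF a(1)] by simp
    moreover have "a = Suc 0" using m a ra[of 0 a] r(3) by fastforce
    ultimately show False using r(3) by auto
  qed
  then obtain D where D: "D \<in> holes G" "{y, r ! 0} \<in> edges D" "verts D \<subseteq> insert y ?A" by blast
  have ne: "r \<noteq> []" using r(3) by auto
  then have "{y, r ! 0} \<in> edges C"
    unfolding r(1) by (subst edges_cycle_graph_Cons) (auto simp: hd_conv_nth)
  then have "D = C" using hole_unique D C by blast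
  moreover have Si: "r ! Suc i \<in> set r" using ij by simp
  ultimately have "r ! Suc i \<in> insert y ?A" using D(3) r(1) by auto
  with Si have "r ! Suc i \<in> set (take (Suc i) r) \<or> r ! Suc i \<in> set (drop j r)"
    using r(1,4) K(2) by auto
  then show False
  proof
    assume "r ! Suc i \<in> set (take (Suc i) r)"
    then obtain a where "a < Suc i" "a < length r" "r ! a = r ! Suc i" by (auto simp: in_set_conv_nth)
    then show False using d ij by (auto simp: nth_eq_iff_index_eq)
  next
    assume "r ! Suc i \<in> set (drop j r)"
    then obtain a where "j + a < length r" "r ! (j + a) = r ! Suc i"
      by (auto simp: in_set_conv_nth less_diff_conv add.commute)
    then show False using d ij j by (auto simp: nth_eq_iff_index_eq)
  qed
qed

lemma attachments_adj_if_missing: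
  assumes C: "C \<in> holes G" and K: "conn K" "K \<inter> verts C = {}"
    and y: "y \<in> verts C" "\<And>k. k \<in> K \<Longrightarrow> \<not> adj y k"
    and ab: "a \<in> verts C" "b \<in> verts C" "k \<in> K" "adj a k" "l \<in> K" "adj b l"
  shows "a = b \<or> adj a b"
proof -
  obtain r where r: "C = cycle_graph (y # r)" "ipath r" "length r \<ge> 3" "y \<notin> set r"
    "\<And>i. i < length r \<Longrightarrow> adj y (r ! i) \<longleftrightarrow> i = 0 \<or> Suc i = length r"
    using hole_at[OF C y(1)] by blast
  have "a \<in> set r" "b \<in> set r" using y(2) ab r(1) by auto
  then obtain i j where i: "i < length r" "r ! i = a" and j: "j < length r" "r ! j = b"
    by (auto simp: in_set_conv_nth)
  note aux = attachment_indices[OF C r K y(2)]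
  have "i = j \<or> j = Suc i \<or> i = Suc j"
    using aux[of i j k l] aux[of j i l k] i j ab by (metis linorder_neqE_nat)
  then show ?thesis using r(2) i j unfolding ipath_def by blast
qed

text \<open>Otherwise \<open>hole_through_edge\<close> yields a hole through the edge
  \<open>{u, v}\<close> inside \<open>K\<close> together with \<open>u\<close> and \<open>v\<close>.
  By edge-disjointness it is \<open>C\<close>, which has only two vertices there.\<close>

lemma common_neighbour:
  assumes C: "C \<in> holes G" and K: "conn K" "K \<inter> verts C = {}"
    and uv: "u \<in> verts C" "v \<in> verts C" "adj u v" "k \<in> K" "adj u k" "l \<in> K" "adj v l"
  shows "\<exists>t\<in>K. adj u t \<and> adj v t"
proof (rule ccontr)
  assume no: "\<not> ?thesis"
  have "reach (insert v K) v l" using uv by (intro reach_step) auto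
  moreover have "reach (insert v K) l k" by (rule reach_mono[OF conn_reach[OF K(1)]]) (use uv in auto)
  ultimately have "reach (insert v K) v k" by (rule reach_trans)
  then have "\<exists>D\<in>holes G. {u, v} \<in> edges D \<and> verts D \<subseteq> insert u (insert v K)"
    using uv no K(2) by (intro hole_through_edge[where w = k]) auto
  then obtain D where D: "D \<in> holes G" "{u, v} \<in> edges D" "verts D \<subseteq> insert u (insert v K)" by blast
  have "{u, v} \<in> edges C" using hole_adj_iff[OF C] uv by blast
  then have "D = C" using hole_unique D C by blast
  then have "verts C \<subseteq> {u, v, v}" using D(3) K(2) by auto
  then show False using hole_not_covered[OF C] by blast
qed

text \<open>A single vertex outside \<open>X_hole G C\<close> misses some vertex of the hole, but a
  larger connected set may touch all of them. So \<open>attachments_adj_if_missing\<close> settles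
  singletons, and in the induction step it shows that a counterexample must touch every vertex of
  \<open>C\<close>.\<close>

lemma attachments_adj:
  assumes "conn K" and C: "C \<in> holes G"
    and "K \<subseteq> verts G" "K \<inter> (verts C \<union> X_hole G C) = {}"
    and "a \<in> verts C" "b \<in> verts C" "k \<in> K" "adj a k" "l \<in> K" "adj b l"
  shows "a = b \<or> adj a b"
  using assms(1,3-)
proof (induction arbitrary: a b k l rule: conn.induct)
  case (singleton x)
  then have "x \<notin> X_hole G C" "x \<in> verts G" by auto
  then obtain y where y: "y \<in> verts C" "\<not> adj y x" by (auto simp: X_hole_def)
  show ?case
    by (rule attachments_adj_if_missing[OF C conn.singleton[of x] _ y(1)]) (use singleton y in auto)
next
  case (extend K h x)
  have cn: "conn (insert x K)" using extend conn.extend by blast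
  have IH: "a = b \<or> adj a b" if "a \<in> verts C" "b \<in> verts C" "k \<in> K" "adj a k" "l \<in> K" "adj b l" for a b k l
    using extend.IH[of a b k l] extend.prems that by auto
  have "x \<notin> X_hole G C" "x \<in> verts G" using extend.prems by auto
  then obtain y where y: "y \<in> verts C" "\<not> adj y x" by (auto simp: X_hole_def)
  have sx: "a = b \<or> adj a b" if "a \<in> verts C" "b \<in> verts C" "adj a x" "adj b x" for a b
    by (rule attachments_adj_if_missing[OF C conn.singleton[of x] _ y(1)]) (use that extend y in auto)
  show ?case
  proof (rule ccontr)
    assume not: "\<not> (a = b \<or> adj a b)"
    have att: "\<exists>k\<in>insert x K. adj z k" if "z \<in> verts C" for z
      using attachments_adj_if_missing[OF C cn _ that, of a b k l] extend.prems not by blast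
    \<comment> \<open>Now every edge of \<open>C\<close> has a common neighbour in \<open>insert x K\<close>, so three consecutive edges are
      covered by the two cliques \<open>N1\<close> and \<open>N2\<close>, one of which then contains a nonadjacent pair.\<close>
    define N1 where "N1 = {z \<in> verts C. adj z x}"
    define N2 where "N2 = {z \<in> verts C. \<exists>k\<in>K. adj z k}"
    have N1: "z = w \<or> adj z w" if "z \<in> N1" "w \<in> N1" for z w using that sx unfolding N1_def by blast
    have N2: "z = w \<or> adj z w" if "z \<in> N2" "w \<in> N2" for z w using that IH unfolding N2_def by blast
    have cov: "{z, w} \<subseteq> N1 \<or> {z, w} \<subseteq> N2" if zw: "z \<in> verts C" "w \<in> verts C" "adj z w" for z w
    proof -
      obtain k where k: "k \<in> insert x K" "adj z k" using att[OF zw(1)] by blast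
      obtain l where l: "l \<in> insert x K" "adj w l" using att[OF zw(2)] by blast
      have "insert x K \<inter> verts C = {}" using extend.prems(2) by blast
      from common_neighbour[OF C cn this zw k l]
      obtain t where "t \<in> insert x K" "adj z t" "adj w t" by blast
      then show ?thesis using zw(1,2) by (auto simp: N1_def N2_def)
    qed
    obtain a b c d where *: "{a, b, c, d} \<subseteq> verts C" "adj a b" "adj b c" "adj c d"
      "a \<noteq> c" "\<not> adj a c" "b \<noteq> d" "\<not> adj b d" "a \<noteq> d"
      by (rule hole_consecutive[OF C])
    then have "{a, b} \<subseteq> N1 \<or> {a, b} \<subseteq> N2" "{b, c} \<subseteq> N1 \<or> {b, c} \<subseteq> N2" "{c, d} \<subseteq> N1 \<or> {c, d} \<subseteq> N2"
      using cov by auto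
    \<comment> \<open>Two of the three edges lie in the same clique, and any two of them together
      contain \<open>a\<close> and \<open>c\<close> or \<open>b\<close> and
      \<open>d\<close>.\<close>
    then show False
      using N1[of a c] N1[of b d] N2[of a c] N2[of b d] *(5-8) by auto
  qed
qed

text \<open>The hole is the 4-cycle \<open>a\<close>, \<open>x\<close>, \<open>b\<close>,
  \<open>y\<close>. Its edge \<open>{a, x}\<close> is recorded so that holes for different choices
  of \<open>b\<close> can be seen to share an edge.\<close>

lemma four_hole:
  assumes "adj a x" "adj a y" "adj b x" "adj b y" "\<not> adj x y" "x \<noteq> y" "\<not> adj a b" "a \<noteq> b"
  shows "\<exists>D\<in>holes G. {a, x} \<in> edges D \<and> verts D \<subseteq> {a, x, y, b}"
proof -
  have "reach {x, y, b} x b" "reach {x, y, b} b y"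
    using assms by (auto intro!: reach_step simp: insert_commute)
  then have r: "reach {x, y, b} x y" by (rule reach_trans)
  have ne: "a \<noteq> x" "a \<noteq> y" using assms by auto
  show ?thesis
    by (rule hole_through_edge[OF _ _ _ _ _ _ r]) (use assms ne in auto)
qed

text \<open>Nonadjacent \<open>x\<close>, \<open>y\<close> form a 4-hole with every nonadjacent pair
  of \<open>C\<close>. If \<open>C\<close> has length at least 5, some \<open>a\<close> has two
  non-neighbours \<open>c\<close>, \<open>d\<close> on \<open>C\<close>, and the two resulting holes
  share the edge \<open>{a, x}\<close>. If \<open>C\<close> has length 4, then \<open>C\<close> with
  \<open>x\<close> and \<open>y\<close> induces \<open>K222\<close>.\<close>

lemma X_hole_clique:
  assumes "K222_free G" and C: "C \<in> holes G" and xy: "x \<in> X_hole G C" "y \<in> X_hole G C" "x \<noteq> y"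
  shows "adj x y"
proof (rule ccontr)
  assume no: "\<not> adj x y"
  have X: "adj c x" "adj c y" if "c \<in> verts C" for c using xy that by (auto simp: X_hole_def)
  have xyV: "x \<in> verts G" "y \<in> verts G" using xy by (auto simp: X_hole_def)
  have xyC: "x \<notin> verts C" "y \<notin> verts C" using X(1)[of x] X(2)[of y] by auto
  obtain a where a: "a \<in> verts C" using hole_nonempty[OF C] by blast
  obtain r where r: "C = cycle_graph (a # r)" "ipath r" "length r \<ge> 3" "a \<notin> set r"
    "\<And>i. i < length r \<Longrightarrow> adj a (r ! i) \<longleftrightarrow> i = 0 \<or> Suc i = length r"
    using hole_at[OF C a] by blast
  obtain b c d s where s: "r = b # c # d # s"
    using r(3) by (metis Suc_le_length_iff numeral_3_eq_3)
  have d: "distinct (a # r)" using r(2,4) by (auto simp: ipath_def)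
  have inC: "a \<in> verts C" "b \<in> verts C" "c \<in> verts C" "d \<in> verts C" using r(1) s by auto
  have "\<not> adj a c" using r(5)[of 1] s by auto
  have bcd: "adj (r ! 0) (r ! 1)" "adj (r ! 1) (r ! 2)" "\<not> adj (r ! 0) (r ! 2)"
    using r(2,3) unfolding ipath_def by auto
  have "adj a b" using r(5)[of 0] s by simp
  show False
  proof (cases "s = []")
    case False
    then have "\<not> adj a d" using r(5)[of 2] s by auto
    obtain D where D: "D \<in> holes G" "{a, x} \<in> edges D" "verts D \<subseteq> {a, x, y, c}"
      using four_hole[of a x y c] X inC no xy(3) \<open>\<not> adj a c\<close> d s by auto
    obtain D' where D': "D' \<in> holes G" "{a, x} \<in> edges D'" "verts D' \<subseteq> {a, x, y, d}"
      using four_hole[of a x y d] X inC no xy(3) \<open>\<not> adj a d\<close> d s by auto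
    have "D' = D" using hole_unique D D' by blast
    then have "verts D \<subseteq> {a, x, y}" using D D' d s by auto
    then show False using hole_not_covered D by blast
  next
    case True
    then have "adj a d" using r(5)[of 2] s by auto
    \<comment> \<open>The three nonadjacent pairs \<open>a\<close>, \<open>c\<close> and
      \<open>b\<close>, \<open>d\<close> and \<open>x\<close>, \<open>y\<close> become the parts;
      the last branch is meant for \<open>y\<close>.\<close>
    define f where "f v = (if v = a then (0, 0) else if v = c then (0, 1) else if v = b then (1, 0)
      else if v = d then (1, 1) else if v = x then (2, 0) else (2::nat, 1::nat))" for v
    let ?S = "{a, b, c, d, x, y}"
    have dist: "distinct [a, b, c, d, x, y]" using d s xyC inC xy(3) by auto
    have SV: "?S \<subseteq> verts G" using inC C xyV by (auto simp: holes_def is_cycle_def)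
    have f: "f a = (0, 0)" "f c = (0, 1)" "f b = (1, 0)" "f d = (1, 1)" "f x = (2, 0)" "f y = (2, 1)"
      using dist by (auto simp: f_def)
    have K: "verts K222 = {(0,0),(0,1),(1,0),(1,1),(2,0),(2,1)}"
      by (auto simp: K222_def Let_def)
    have KE: "{p, q} \<in> edges K222 \<longleftrightarrow> p \<in> verts K222 \<and> q \<in> verts K222 \<and> fst p \<noteq> fst q" for p q
    proof -
      have "(\<exists>x y. {p, q} = {x, y} \<and> x \<in> V \<and> y \<in> V \<and> fst x \<noteq> fst y) \<longleftrightarrow>
        p \<in> V \<and> q \<in> V \<and> fst p \<noteq> fst q" for V :: "(nat \<times> nat) set"
        unfolding doubleton_eq_iff by metis
      then show ?thesis unfolding K222_def Let_def graph.sel mem_Collect_eq .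
    qed
    have iv: "verts (induced_subgraph G ?S) = ?S" using SV by (auto simp: induced_subgraph_def)
    have bij: "bij_betw f ?S (verts K222)"
      using dist unfolding bij_betw_def K by (auto simp: f)
    have e: "adj a b" "adj b c" "adj c d" "adj a d" "\<not> adj a c" "\<not> adj b d"
      "adj a x" "adj b x" "adj c x" "adj d x" "adj a y" "adj b y" "adj c y" "adj d y" "\<not> adj x y"
      using \<open>adj a b\<close> \<open>adj a d\<close> \<open>\<not> adj a c\<close> bcd X inC no s by auto
    have e': "adj b a" "adj c b" "adj d c" "adj d a" "\<not> adj c a" "\<not> adj d b"
      "adj x a" "adj x b" "adj x c" "adj x d" "adj y a" "adj y b" "adj y c" "adj y d" "\<not> adj y x"
      using e by (simp_all add: insert_commute)
    have "\<forall>u\<in>?S. \<forall>v\<in>?S. adj u v \<longleftrightarrow> {f u, f v} \<in> edges K222"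
      unfolding KE K by (simp add: f e e')
    moreover have "{u, v} \<in> edges (induced_subgraph G ?S) \<longleftrightarrow> adj u v" if "u \<in> ?S" "v \<in> ?S" for u v
      using that by (simp add: induced_subgraph_def)
    ultimately have "isomorphic (induced_subgraph G ?S) K222"
      unfolding isomorphic_def iv using bij by (intro exI[of _ f]) blast
    then show False using assms(1) SV unfolding K222_free_def by blast
  qed
qed

end

section \<open>The cut at an edge of a hole\<close>

locale edge_of_hole = hole_edge_disjoint_graph +
  fixes C u v
  assumes hole: "C \<in> holes G" and edge: "{u, v} \<in> edges C"
begin

text \<open>This set does not depend on the edge, so walks obtained for two different edges of
  \<open>C\<close> can be joined inside it.\<close>

abbreviation (input) "W \<equiv> verts G - (verts C \<union> X_hole G C)"
abbreviation (input) "X \<equiv> X_edge G C {u, v}"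
abbreviation (input) "Q \<equiv> Q_edge G C {u, v}"
abbreviation (input) "T \<equiv> T_edge G C {u, v}"

lemma ends: "u \<in> verts C" "v \<in> verts C" "adj u v" "u \<noteq> v"
proof -
  show *: "u \<in> verts C" "v \<in> verts C" using edge_of_hole_subset[OF hole edge] by auto
  show "adj u v" using hole_adj_iff[OF hole *] edge by simp
  then show "u \<noteq> v" by auto
qed

lemma hole_subset: "verts C \<subseteq> verts G"
  using hole by (simp add: holes_def is_cycle_def)

lemma X_hole_disjoint: "x \<in> X_hole G C \<Longrightarrow> x \<notin> verts C"
  by (auto simp: X_hole_def)

lemma X_subset: "X \<subseteq> verts G"
  using ends hole_subset by (auto simp: X_edge_def X_hole_def)

lemma attachments_adj_reach:
  assumes "k \<in> W" "reach W k l" "a \<in> verts C" "b \<in> verts C" "adj a k" "adj b l"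
  shows "a = b \<or> adj a b"
proof -
  obtain K where "K \<subseteq> W" "conn K" "k \<in> K" "l \<in> K"
    using reach_conn[OF assms(2,1)] by blast
  then show ?thesis using attachments_adj[OF _ hole, of K a b k l] assms by blast
qed

lemma common_neighbour_reach:
  assumes "k \<in> W" "reach W k l" "a \<in> verts C" "b \<in> verts C" "adj a b" "adj a k" "adj b l"
  shows "\<exists>t\<in>W. adj a t \<and> adj b t"
proof -
  obtain K where "K \<subseteq> W" "conn K" "k \<in> K" "l \<in> K"
    using reach_conn[OF assms(2,1)] by blast
  then show ?thesis using common_neighbour[OF hole, of K a b k l] assms by blast
qed

text \<open>Both orientations of the edge impose the same condition on \<open>t\<close>. A list of
  three vertices has \<open>t\<close> as its only inner vertex, and the length-1 clause of
  \<open>avoiding\<close> is vacuous for it.\<close>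

lemma T_edge_iff: "t \<in> T \<longleftrightarrow> t \<in> W \<and> adj u t \<and> adj v t"
proof -
  have P: "[a, t, b] \<in> avoiding_paths G C {u, v} \<longleftrightarrow> t \<in> W \<and> adj u t \<and> adj v t"
    if "{u, v} = {a, b}" for a b
  proof -
    have ab: "a = u \<and> b = v \<or> a = v \<and> b = u" using that by (auto simp: doubleton_eq_iff)
    have "a \<noteq> b" using ab ends(4) by auto
    have "(\<forall>i. Suc i < length [a, t, b] \<longrightarrow> {[a, t, b] ! i, [a, t, b] ! Suc i} \<in> edges G) \<longleftrightarrow>
        adj a t \<and> adj t b"
      by (auto simp: less_Suc_eq)
    moreover have "distinct [a, t, b] \<and> set [a, t, b] \<subseteq> verts G" if "adj a t" "adj t b"
      using that adj_in_verts[of a t] adj_in_verts[of t b] \<open>a \<noteq> b\<close> by auto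
    ultimately have path: "is_path G [a, t, b] \<longleftrightarrow> adj a t \<and> adj t b"
      unfolding is_path_def by blast
    have avoid: "avoiding G C [a, t, b] \<longleftrightarrow> t \<notin> verts C \<union> X_hole G C"
      by (simp add: avoiding_def inner_verts_def)
    have "{hd [a, t, b], last [a, t, b]} = {u, v}" using that by simp
    then have "[a, t, b] \<in> avoiding_paths G C {u, v} \<longleftrightarrow>
        (adj a t \<and> adj t b) \<and> t \<notin> verts C \<union> X_hole G C"
      unfolding avoiding_paths_def mem_Collect_eq path avoid by blast
    moreover have "adj t b \<longleftrightarrow> adj b t" by (simp add: insert_commute)
    moreover have "adj a t \<Longrightarrow> t \<in> verts G" using adj_in_verts by blast
    ultimately show ?thesis using ab by auto
  qed
  have "t \<in> T \<longleftrightarrow> (\<exists>a b. {u, v} = {a, b} \<and> [a, t, b] \<in> avoiding_paths G C {u, v})"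
    by (simp add: T_edge_def)
  then show ?thesis using P by metis
qed

lemma rest_nonempty: "verts C - {u, v} \<noteq> {}"
  using hole_not_covered[OF hole, of u v v] by auto

text \<open>This justifies the definite description: the rest of the hole is connected and disjoint
  from \<open>X\<close>, so it lies in one component, and two components sharing \<open>q\<close>
  coincide.\<close>

lemma Q_edge_eq:
  assumes q: "q \<in> verts C - {u, v}"
  shows "Q = {w. reach (verts G - X) q w}"
proof -
  let ?R = "verts G - X"
  have sub: "verts C - {u, v} \<subseteq> ?R"
    using hole_subset X_hole_disjoint by (auto simp: X_edge_def)
  have comps: "components (delete_verts G X) = (\<lambda>v. {w. reach ?R v w}) ` ?R"
    unfolding delete_verts_def by (rule components_induced) simp
  show ?thesis unfolding Q_edge_def comps
  proof (rule the_equality, intro conjI)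
    show "{w. reach ?R q w} \<in> (\<lambda>v. {w. reach ?R v w}) ` ?R" using sub q by blast
    show "verts C - {u, v} \<subseteq> {w. reach ?R q w}"
      using hole_minus_edge_connected[OF hole edge q] reach_mono[OF _ sub] by blast
    fix K assume "K \<in> (\<lambda>v. {w. reach ?R v w}) ` ?R \<and> verts C - {u, v} \<subseteq> K"
    then show "K = {w. reach ?R q w}" using q reach_class_eq by blast
  qed
qed

lemma rest_subset_Q: "verts C - {u, v} \<subseteq> Q"
proof
  fix q assume "q \<in> verts C - {u, v}"
  from Q_edge_eq[OF this] show "q \<in> Q" by simp
qed

lemma outside_subset: "verts G - X - Q \<subseteq> W"
  using rest_subset_Q by (auto simp: X_edge_def)

lemma U_edge_cases:
  assumes "x \<in> U_edge G C {u, v}"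
  obtains t where "x \<in> W" "reach W x t" "adj u t" "adj v t"
proof -
  let ?A = "verts G - X - Q"
  from assms obtain K t where K: "K \<in> components (induced_subgraph G ?A)" "x \<in> K" "t \<in> K" "t \<in> T"
    unfolding U_edge_def delete_verts_twice by blast
  then obtain k where k: "k \<in> ?A" "K = {w. reach ?A k w}"
    by (subst (asm) components_induced) blast+
  then have "x \<in> ?A" using K reach_in by blast
  moreover have "reach ?A x t" using k K reach_sym reach_trans by blast
  ultimately show thesis
    using that[of t] K(4) T_edge_iff outside_subset reach_mono by blast
qed

text \<open>The interior of an avoiding path is a connected piece of \<open>W\<close> attached to
  both ends of the edge, so \<open>common_neighbour_reach\<close> applies.\<close>

lemma T_nonempty:
  assumes "S_edge G C {u, v} \<noteq> {}"
  shows "T \<noteq> {}"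
proof -
  obtain s where "s \<in> S_edge G C {u, v}" using assms by blast
  then obtain p where "p \<in> avoiding_paths G C {u, v}" and s: "s \<in> set p" "s \<notin> {u, v}"
    unfolding S_edge_def by auto
  then have p: "is_path G p" "{hd p, last p} = {u, v}" "avoiding G C p"
    unfolding avoiding_paths_def by auto
  have hl: "hd p \<noteq> last p" using p(2) ends(4) by (metis doubleton_eq_iff)
  obtain h q where hq: "p = h # q" using p(1) by (cases p) (auto simp: is_path_def)
  have "q \<noteq> []" using hl hq by auto
  then obtain m l where "q = m @ [l]" by (metis rev_exhaust)
  then have pm: "p = h # m @ [l]" using hq by simp
  then have hl: "{h, l} = {u, v}" using p(2) by simp
  have inner: "inner_verts p = set m" by (simp add: inner_verts_def pm butlast_append)
  have mW: "set m \<subseteq> W" using p(1,3) inner by (auto simp: avoiding_def is_path_def pm)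
  \<comment> \<open>The vertex \<open>s\<close> rules out that the path is just the edge. The
    interior \<open>m\<close> occupies the indices 1 to \<open>length m\<close> of
    \<open>p\<close>.\<close>
  have "s \<in> set m" using s hl pm by (auto simp: doubleton_eq_iff)
  then have m0: "length m > 0" by auto
  have adjp: "adj (p ! i) (p ! Suc i)" if "Suc i < length p" for i
    using p(1) that by (simp add: is_path_def)
  have pW: "p ! i \<in> W" if "1 \<le> i" "i \<le> length m" for i
  proof -
    have "p ! i \<in> set m" using that by (cases i) (auto simp: pm nth_append)
    then show ?thesis using mW by blast
  qed
  have "reach W (p ! 1) (p ! length m)"
  proof (rule reach_chain)
    show "adj (p ! i) (p ! Suc i)" if "1 \<le> i" "i < length m" for i
      using that by (intro adjp) (simp add: pm)
    show "1 \<le> length m" using m0 by linarith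
  qed (rule pW)
  moreover have "p ! 1 \<in> W" using pW[of 1] m0 by simp
  moreover have "adj h (p ! 1)" using adjp[of 0] by (simp add: pm)
  moreover have "p ! Suc (length m) = l" by (simp add: pm)
  then have "adj l (p ! length m)" using adjp[of "length m"] by (simp add: pm insert_commute)
  moreover have "h \<in> verts C" "l \<in> verts C" "adj h l" using hl ends adj_sym[OF ends(3)] by (auto simp: doubleton_eq_iff)
  ultimately obtain t where t: "t \<in> W" "adj h t" "adj l t" using common_neighbour_reach by blast
  then have "adj u t" "adj v t" using hl by (auto simp: doubleton_eq_iff)
  then show ?thesis using T_edge_iff t by blast
qed

text \<open>A walk from \<open>t\<close> to the rest of the hole that avoids \<open>X\<close> first
  meets \<open>C\<close> at some \<open>c\<close> outside the edge. Its part in \<open>W\<close> is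
  attached to \<open>u\<close>, \<open>v\<close> and \<open>c\<close>, which would form a triangle
  in \<open>C\<close>.\<close>

lemma T_edge_not_in_Q:
  assumes t: "t \<in> T"
  shows "t \<notin> Q"
proof
  let ?R = "verts G - X"
  assume "t \<in> Q"
  obtain q where q: "q \<in> verts C - {u, v}" using rest_nonempty by blast
  have tW: "t \<in> W" "adj u t" "adj v t" using t T_edge_iff by auto
  have "reach ?R t q" using \<open>t \<in> Q\<close> Q_edge_eq[OF q] reach_sym by blast
  \<comment> \<open>Invariant for the current end of the walk: either it is still reached inside
    \<open>W\<close>, or the walk has already touched the rest of \<open>C\<close>. As
    \<open>q\<close> lies on \<open>C\<close>, the second alternative holds at the end.\<close>
  then have "q \<in> W \<and> reach W t q \<or> (\<exists>k c. reach W t k \<and> adj c k \<and> c \<in> verts C - {u, v})"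
  proof (induction rule: reach_induct)
    case (step y z)
    show ?case
    proof (cases "y \<in> W \<and> reach W t y")
      case True
      show ?thesis
      proof (cases "z \<in> verts C")
        case True
        then have "z \<in> verts C - {u, v}" "adj z y" using step by (auto simp: X_edge_def insert_commute)
        then show ?thesis using \<open>y \<in> W \<and> reach W t y\<close> by blast
      next
        case False
        then have "z \<in> W" using step by (auto simp: X_edge_def)
        then show ?thesis using True step reach_step[of y W z] reach_trans by blast
      qed
    qed (use step in blast)
  qed (use tW in simp)
  then obtain k c where kc: "reach W t k" "adj c k" "c \<in> verts C - {u, v}" using q by blast
  have "adj u c" "adj v c"
    using attachments_adj_reach[OF tW(1) kc(1), of u c] attachments_adj_reach[OF tW(1) kc(1), of v c]
      tW kc ends by auto
  then show False using no_triangle[OF hole, of u v c] ends kc by auto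
qed

text \<open>\<open>Q\<close> is a whole component of \<open>G - X\<close>, so deleting it leaves the
  other components unchanged.\<close>

lemma U_edge_components:
  "{K \<in> components (delete_verts (delete_verts G X) Q). K \<inter> T \<noteq> {}} \<subseteq> components (delete_verts G X)"
proof
  let ?R = "verts G - X"
  fix K assume "K \<in> {K \<in> components (delete_verts (delete_verts G X) Q). K \<inter> T \<noteq> {}}"
  then obtain k where k: "k \<in> ?R - Q" "K = {w. reach (?R - Q) k w}"
    unfolding delete_verts_twice by (subst (asm) components_induced) blast+
  obtain q where q: "q \<in> verts C - {u, v}" using rest_nonempty by blast
  have "w \<notin> Q \<and> reach (?R - Q) k w" if "reach ?R k w" for w
    using that
  proof (induction rule: reach_induct)
    case (step y z)
    have "reach ?R y z" using step by (intro reach_step) auto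
    then have "z \<notin> Q" using step Q_edge_eq[OF q] reach_sym reach_trans by blast
    moreover have "reach (?R - Q) y z" using step \<open>z \<notin> Q\<close> by (intro reach_step) auto
    ultimately show ?case using step reach_trans by blast
  qed (use k in simp)
  moreover have "reach ?R k w" if "reach (?R - Q) k w" for w
    using that by (rule reach_mono) blast
  ultimately have "K = {w. reach ?R k w}" unfolding k(2) by blast
  then show "K \<in> components (delete_verts G X)"
    unfolding delete_verts_def using k(1) by (subst components_induced) blast+
qed

lemma T_meets_component:
  assumes t: "t \<in> T"
  shows "\<exists>K \<in> components (delete_verts (delete_verts G X) Q). t \<in> K"
proof -
  have "t \<in> verts G - X - Q"
    using t T_edge_iff T_edge_not_in_Q ends by (auto simp: X_edge_def)
  then show ?thesis
    unfolding delete_verts_twice by (subst components_induced) (blast, force)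
qed

lemma X_edge_clique:
  assumes "K222_free G" "x \<in> X" "y \<in> X" "x \<noteq> y"
  shows "adj x y"
proof -
  have 1: "adj a b" "adj b a" if "a \<in> verts C" "b \<in> X_hole G C" for a b
    using that by (auto simp: X_hole_def insert_commute)
  have "adj v u" using ends(3) by (rule adj_sym)
  then show ?thesis
    using assms(2-4) ends 1 X_hole_clique[OF assms(1) hole] unfolding X_edge_def by blast
qed

lemma X_edge_clique_cut:
  assumes "K222_free G" and t: "t \<in> T"
  shows "clique_cut G X"
proof -
  let ?R = "verts G - X" and ?V = "verts G"
  obtain q where q: "q \<in> verts C - {u, v}" using rest_nonempty by blast
  have tW: "t \<in> W" "adj u t" "adj v t" using t T_edge_iff by auto
  have tQ: "t \<in> ?R" "\<not> reach ?R q t"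
    using tW T_edge_not_in_Q[OF t] Q_edge_eq[OF q] ends by (auto simp: X_edge_def)
  have qR: "q \<in> ?R" using q hole_subset X_hole_disjoint by (auto simp: X_edge_def)
  have cR: "components (delete_verts G X) = (\<lambda>v. {w. reach ?R v w}) ` ?R"
    unfolding delete_verts_def by (rule components_induced) simp
  have cV: "components G = (\<lambda>v. {w. reach ?V v w}) ` ?V"
    unfolding components_def using component_of_eq by auto
  \<comment> \<open>The component \<open>Q0\<close> can be dropped because \<open>t\<close> lies in another component of \<open>G - X\<close>
    but in the same component of \<open>G\<close>.\<close>
  define g where "g K = {w. reach ?V (SOME x. x \<in> K) w}" for K
  define Q0 where "Q0 = {w. reach ?R q w}"
  have ut: "reach ?V u t" using ends tW hole_subset by (intro reach_step) auto
  have qu: "reach ?V q u" using hole_connected[OF hole, of q u] reach_mono[OF _ hole_subset] q ends by blast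
  \<comment> \<open>Every component of \<open>G\<close> retains a vertex of \<open>G - X\<close>
    outside \<open>Q0\<close>: from a vertex of \<open>Q0\<close> or of the clique \<open>X\<close>
    one reaches \<open>u\<close>, and thus \<open>t\<close>.\<close>
  have ex: "\<exists>x\<in>?R. \<not> reach ?R q x \<and> reach ?V z x" if z: "z \<in> ?V" for z
  proof -
    consider "z \<in> ?R" "\<not> reach ?R q z" | "reach ?R q z" | "z \<in> X" using z by blast
    then show ?thesis
    proof cases
      case 2
      then have "reach ?V z q" using reach_sym reach_mono[of ?R q z ?V] by blast
      then show ?thesis using tQ ut qu reach_trans by blast
    next
      case 3
      have "reach ?V z u"
      proof (cases "z = u")
        case False
        moreover have "u \<in> X" by (simp add: X_edge_def)
        ultimately have "adj z u" using X_edge_clique[OF assms(1) 3] by blast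
        then show ?thesis using z ends hole_subset by (intro reach_step) auto
      qed simp
      then show ?thesis using tQ ut reach_trans by blast
    qed (use z in auto)
  qed
  have "components G \<subseteq> g ` (components (delete_verts G X) - {Q0})"
  proof
    fix K assume "K \<in> components G"
    then obtain z where z: "z \<in> ?V" "K = {w. reach ?V z w}" using cV by auto
    obtain x where x: "x \<in> ?R" "\<not> reach ?R q x" "reach ?V z x" using ex[OF z(1)] by blast
    let ?K = "{w. reach ?R x w}"
    have "(SOME y. y \<in> ?K) \<in> ?K" by (rule someI[of _ x]) simp
    then have "reach ?V x (SOME y. y \<in> ?K)" using reach_mono[of ?R _ _ ?V] by auto
    then have "g ?K = K" unfolding g_def z(2) using x(3) reach_trans reach_class_eq by metis
    moreover have "?K \<noteq> Q0" using x(2) unfolding Q0_def by (metis mem_Collect_eq reach_refl)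
    ultimately show "K \<in> g ` (components (delete_verts G X) - {Q0})" using x(1) cR by blast
  qed
  moreover have fin: "finite (components (delete_verts G X))"
    using cR finite_simple by (simp add: finite_simple_graph_def)
  ultimately have "card (components G) \<le> card (components (delete_verts G X) - {Q0})"
    by (meson card_image_le card_mono finite_Diff finite_imageI order_trans)
  also have "\<dots> < card (components (delete_verts G X))"
    using fin cR qR unfolding Q0_def by (intro card_Diff1_less) auto
  finally have "card (components G) < card (components (delete_verts G X))" .
  moreover have "complete (induced_subgraph G X)"
    using X_edge_clique[OF assms(1)] by (auto simp: complete_def induced_subgraph_def)
  ultimately show ?thesis using X_subset by (simp add: clique_cut_def)
qed

end

section \<open>Counting holes\<close>

theorem theorem2p2:
  fixes G :: "'a graph"
  assumes "finite_simple_graph G"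
    and "K222_free G"
    and "hole_edge_disjoint G"
    and "\<exists>C\<in>holes G. card {e \<in> edges C. S_edge G C e \<noteq> {}} \<ge> card (holes G)"
  shows "chordal_property G \<and> (\<exists>X. chordal_cut G X)"
proof -
  interpret hole_edge_disjoint_graph G by standard (rule assms)+
  obtain C where C: "C \<in> holes G" and le: "card (holes G) \<le> card {e \<in> edges C. S_edge G C e \<noteq> {}}"
    using assms(4) by blast
  define F where "F = {e \<in> edges C. S_edge G C e \<noteq> {}}"
  have F_edge: "\<exists>u v. e = {u, v} \<and> edge_of_hole G C u v" if "e \<in> F" for e
  proof -
    have e: "e \<in> edges C" using that F_def by simp
    then have "e \<in> edges G" using C by (auto simp: holes_def is_cycle_def)
    then obtain u v where "e = {u, v}" by (rule edge_cases)
    moreover have "edge_of_hole G C u v" by unfold_locales (use e C calculation in auto)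
    ultimately show ?thesis by blast
  qed
  have "edges C \<subseteq> edges G" using C by (auto simp: holes_def is_cycle_def)
  then have finF: "finite F" using finite_edges by (auto simp: F_def intro: finite_subset)
  have "\<exists>e\<in>F. chordal (induced_subgraph G (U_edge G C e \<union> X_edge G C e))"
  proof (rule ccontr)
    assume "\<not> ?thesis"
    then have "\<forall>e\<in>F. \<exists>D. D \<in> holes (induced_subgraph G (U_edge G C e \<union> X_edge G C e))"
      by (auto simp: chordal_def)
    then obtain H where H: "\<And>e. e \<in> F \<Longrightarrow> H e \<in> holes (induced_subgraph G (U_edge G C e \<union> X_edge G C e))"
      by metis
    have HG: "H e \<in> holes G" "verts (H e) \<subseteq> U_edge G C e \<union> X_edge G C e" if "e \<in> F" for e
      using holes_induced_subgraph[OF H[OF that]] by auto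
    \<comment> \<open>The hole \<open>C\<close> has a vertex off the edge \<open>e\<close>; it lies
      neither in \<open>X_hole G C\<close> nor in \<open>W\<close>, whereas
      \<open>U_edge G C e\<close> is contained in \<open>W\<close>.\<close>
    have nC: "H e \<noteq> C" if e: "e \<in> F" for e
    proof
      assume "H e = C"
      obtain u v where uv: "e = {u, v}" "edge_of_hole G C u v" using F_edge e by blast
      interpret E: edge_of_hole G C u v by (rule uv)
      obtain q where q: "q \<in> verts C - {u, v}" using E.rest_nonempty by blast
      then have "q \<notin> U_edge G C {u, v}" using E.U_edge_cases[of q] by blast
      moreover have "q \<notin> X_edge G C {u, v}" using q E.X_hole_disjoint by (auto simp: X_edge_def)
      ultimately show False using HG(2)[OF e] \<open>H e = C\<close> uv(1) q by blast
    qed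
    have "inj_on H F"
    proof (rule inj_onI, rule ccontr)
      fix e f assume ef: "e \<in> F" "f \<in> F" "H e = H f" "e \<noteq> f"
      obtain u v where uv: "e = {u, v}" "edge_of_hole G C u v" using F_edge ef by blast
      obtain w z where wz: "f = {w, z}" "edge_of_hole G C w z" using F_edge ef by blast
      interpret E: edge_of_hole G C u v by (rule uv)
      interpret F: edge_of_hole G C w z by (rule wz)
      obtain a b where ab: "a \<in> verts (H e)" "b \<in> verts (H e)" "a \<noteq> b" "\<not> adj a b"
        using hole_not_clique[OF HG(1)[OF ef(1)]] by blast
      then have "\<not> (a \<in> X_edge G C e \<and> b \<in> X_edge G C e)"
        using E.X_edge_clique[OF assms(2)] uv(1) by blast
      then obtain x where x: "x \<in> verts (H e)" "x \<in> U_edge G C e" using ab HG(2)[OF ef(1)] by blast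
      obtain s where s: "x \<in> E.W" "reach E.W x s" "adj u s" "adj v s"
        using E.U_edge_cases x(2) uv(1) by blast
      \<comment> \<open>Membership in \<open>W\<close> excludes \<open>x\<close> from the separator
        of every edge of \<open>C\<close>, so the shared hole puts \<open>x\<close> into both
        \<open>U_edge G C e\<close> and \<open>U_edge G C f\<close>.\<close>
      have "x \<notin> X_edge G C f" using s(1) F.ends wz(1) by (auto simp: X_edge_def)
      then have "x \<in> U_edge G C f" using x(1) HG(2)[OF ef(2)] ef(3) by auto
      then obtain t where t: "reach E.W x t" "adj w t" "adj z t"
        using F.U_edge_cases wz(1) by blast
      have "s \<in> E.W" using reach_in s by blast
      have "reach E.W s t" using s(2) t(1) reach_sym reach_trans by blast
      note att = E.attachments_adj_reach[OF \<open>s \<in> E.W\<close> this]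
      \<comment> \<open>The walk from \<open>s\<close> to \<open>t\<close> is attached to the ends
        of both edges. An end of \<open>f\<close> that is not an end of \<open>e\<close> would thus
        form a triangle with \<open>u\<close> and \<open>v\<close>.\<close>
      have "u = w \<or> adj u w" "v = w \<or> adj v w" "u = z \<or> adj u z" "v = z \<or> adj v z"
        using att s t E.ends F.ends by blast+
      moreover have "w \<notin> {u, v} \<or> z \<notin> {u, v}"
        using ef(4) uv(1) wz(1) F.ends(4) by auto
      ultimately show False
        using no_triangle[OF C, of u v w] no_triangle[OF C, of u v z] E.ends F.ends by auto
    qed
    then have "card (insert C (H ` F)) = Suc (card F)"
      using finF nC by (subst card_insert_disjoint) (auto simp: card_image)
    moreover have "card (insert C (H ` F)) \<le> card (holes G)"
      using C HG(1) finite_holes by (intro card_mono) auto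
    ultimately show False using le F_def by simp
  qed
  then obtain e where e: "e \<in> F" "chordal (induced_subgraph G (U_edge G C e \<union> X_edge G C e))" by blast
  have cp: "chordal_property G"
    unfolding chordal_property_def using C e F_def by blast
  obtain u v where uv: "e = {u, v}" "edge_of_hole G C u v" using F_edge e by blast
  interpret E: edge_of_hole G C u v by (rule uv)
  obtain t where t: "t \<in> T_edge G C {u, v}" using E.T_nonempty e(1) uv(1) F_def by blast
  have "chordal_cut G (X_edge G C e)"
    unfolding chordal_cut_def
  proof (intro conjI exI)
    show "clique_cut G (X_edge G C e)" using E.X_edge_clique_cut[OF assms(2) t] uv(1) by simp
    let ?K = "{K \<in> components (delete_verts (delete_verts G (X_edge G C e)) (Q_edge G C e)). K \<inter> T_edge G C e \<noteq> {}}"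
    show "?K \<subseteq> components (delete_verts G (X_edge G C e))" using E.U_edge_components uv(1) by simp
    \<comment> \<open>Since \<open>e\<close> lies in \<open>F\<close>, its \<open>S_edge\<close> is
      nonempty; this provided \<open>t\<close>, whose component belongs to the family.\<close>
    show "?K \<noteq> {}" using E.T_meets_component[OF t] t uv(1) by blast
    show "chordal (induced_subgraph G (\<Union> ?K \<union> X_edge G C e))"
      using e(2) unfolding U_edge_def .
  qed
  then show ?thesis using cp by blast
qed

end
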